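(* For every prime power $q\geq 2$, $$t(2,q)\geq \left\lceil \sqrt{2q+\tfrac14}+\tfrac32\right\rceil .$$
   Context: $\mathbb{P}^2(\mathbb{F}_q)$ is the projective plane over the field $\mathbb{F}_q$ with $q$ elements. A $k$-arc is a set of $k$ points of $\mathbb{P}^2(\mathbb{F}_q)$ no three of which are collinear; it is complete if it is not contained in a $(k+1)$-arc. $t(2,q)$ is the size of the smallest complete $k$-arc in $\mathbb{P}^2(\mathbb{F}_q)$. *)

theory Defs
  imports "HOL-Analysis.Cartesian_Space" "HOL-Number_Theory.Prime_Powers"
begin

(* A field with q elements is a type 'a :: {field, finite} with CARD('a) = q.  Points and lines
   of the projective plane over it are the 1- and 2-dimensional subspaces of 'a^3, and
   incidence is inclusion. *)

definition proj_points :: "('a :: {field, finite} ^ 3) set set" where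
  "proj_points = {P. vec.subspace P \<and> vec.dim P = 1}"

definition proj_lines :: "('a :: {field, finite} ^ 3) set set" where
  "proj_lines = {L. vec.subspace L \<and> vec.dim L = 2}"

definition proj_collinear :: "('a :: {field, finite} ^ 3) set set \<Rightarrow> bool" where
  "proj_collinear S \<longleftrightarrow> (\<exists>L \<in> proj_lines. \<forall>P \<in> S. P \<subseteq> L)"

definition is_arc :: "nat \<Rightarrow> ('a :: {field, finite} ^ 3) set set \<Rightarrow> bool" where
  "is_arc k K \<longleftrightarrow> K \<subseteq> proj_points \<and> card K = k \<and>
     (\<forall>S \<subseteq> K. card S = 3 \<longrightarrow> \<not> proj_collinear S)"

definition is_complete_arc :: "nat \<Rightarrow> ('a :: {field, finite} ^ 3) set set \<Rightarrow> bool" where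
  "is_complete_arc k K \<longleftrightarrow> is_arc k K \<and> \<not> (\<exists>K'. is_arc (k + 1) K' \<and> K \<subseteq> K')"

(* The number t(2,q), for q = CARD('a).  The minimum exists: the plane is finite, so every arc
   is contained in a complete one. *)
definition t2 :: "'a :: {field, finite} itself \<Rightarrow> nat" where
  "t2 _ = (LEAST k. \<exists>K :: ('a ^ 3) set set. is_complete_arc k K)"

end

theory Submission
  imports Defs
begin

text \<open>
  Let \<open>K\<close> be a complete \<open>k\<close>-arc. After squaring, the claimed inequality reads
  \<open>2 * q \<le> (k - 1) * (k - 2)\<close>, that is, \<open>q \<le> (k - 1) choose 2\<close>. Counting all points of the
  plane against all secants of \<open>K\<close> gives a slightly weaker bound; the sharper one comes from
  counting on a single tangent.

  Completeness means that every point off \<open>K\<close> lies on a secant, a line joining two points of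
  \<open>K\<close> (\<open>complete_arc_secant_through\<close>). Fix \<open>P\<close> in \<open>K\<close> and suppose that some line \<open>T\<close> meets \<open>K\<close>
  in \<open>P\<close> only. The other \<open>q\<close> points of \<open>T\<close> are off \<open>K\<close>, so each lies on a secant. Such a
  secant differs from \<open>T\<close>, hence avoids \<open>P\<close> and meets \<open>T\<close> in one point only. Thus the \<open>q\<close>
  points need \<open>q\<close> distinct pairs of points of \<open>K - {P}\<close> (\<open>complete_arc_tangent_card\<close>).
  If there is no such \<open>T\<close>, each of the \<open>q + 1\<close> lines through \<open>P\<close> contains another point of
  \<open>K\<close>, so \<open>k \<ge> q + 2\<close> (\<open>arc_all_lines_secant_card\<close>), which is more than enough.

  A line through \<open>P\<close> is represented below by a vector \<open>v\<close> outside \<open>P\<close>, as the span of \<open>P\<close> and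
  \<open>v\<close>. It passes through another point \<open>B\<close> if and only if \<open>v\<close> is in the span of \<open>P \<union> B\<close>.
\<close>

lemma proj_point_span:
  assumes "P \<in> proj_points"
  obtains p where "p \<noteq> 0" "P = vec.span {p}"
proof -
  have P: "vec.subspace P" "vec.dim P = 1" using assms by (auto simp: proj_points_def)
  obtain B where B: "B \<subseteq> P" "vec.independent B" "P \<subseteq> vec.span B" "card B = vec.dim P"
    using vec.basis_exists by blast
  then obtain p where p: "B = {p}" using P(2) by (auto simp: card_1_singleton_iff)
  have "P = vec.span {p}"
    using B p P(1) by (metis subset_antisym vec.span_minimal)
  moreover have "p \<noteq> 0" using B(2) p by (auto simp: vec.dependent_zero)
  ultimately show ?thesis using that by blast
qed

lemma span_nonzero_in_proj_points:
  assumes "p \<noteq> 0"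
  shows "vec.span {p} \<in> proj_points"
  using assms by (simp add: proj_points_def)

text \<open>
  The join has dimension at least 2, since otherwise it would coincide with both one-dimensional
  spaces \<open>P\<close> and \<open>Q\<close>. Being contained in \<open>L\<close>, it fills \<open>L\<close>.
\<close>

lemma proj_line_eq_join:
  assumes "P \<in> proj_points" "Q \<in> proj_points" "P \<noteq> Q"
    and "L \<in> proj_lines" "P \<subseteq> L" "Q \<subseteq> L"
  shows "L = vec.span (P \<union> Q)"
proof -
  let ?J = "vec.span (P \<union> Q)"
  have P: "vec.subspace P" "vec.dim P = 1" and Q: "vec.subspace Q" "vec.dim Q = 1"
    and L: "vec.subspace L" "vec.dim L = 2"
    using assms by (auto simp: proj_points_def proj_lines_def)
  have sub: "P \<subseteq> ?J" "Q \<subseteq> ?J" by (auto intro: vec.span_base)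
  have "\<not> vec.dim ?J \<le> 1"
    using vec.subspace_dim_equal[of P ?J] vec.subspace_dim_equal[of Q ?J] P Q sub \<open>P \<noteq> Q\<close>
    by (metis vec.subspace_span)
  moreover have "?J \<subseteq> L"
    using assms L by (simp add: vec.span_minimal)
  ultimately show ?thesis
    using vec.subspace_dim_equal[of ?J L] L by (metis vec.subspace_span not_less_eq_eq Suc_1)
qed

text \<open>
  The set \<open>insert Q K\<close> is not an arc, so it has a collinear triple. This triple contains \<open>Q\<close>, as
  \<open>K\<close> is an arc; its other two members span the secant.
\<close>

lemma complete_arc_secant_through:
  fixes K :: "('a :: {field, finite} ^ 3) set set"
  assumes "is_complete_arc k K" "Q \<in> proj_points" "Q \<notin> K"
  obtains A B L where "A \<in> K" "B \<in> K" "A \<noteq> B" "L \<in> proj_lines" "A \<subseteq> L" "B \<subseteq> L" "Q \<subseteq> L"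
proof -
  have arc: "is_arc k K" and "\<not> is_arc (k + 1) (insert Q K)"
    using assms by (auto simp: is_complete_arc_def)
  moreover have "insert Q K \<subseteq> proj_points" "card (insert Q K) = k + 1"
    using arc assms by (auto simp: is_arc_def)
  ultimately obtain S where S: "S \<subseteq> insert Q K" "card S = 3" "proj_collinear S"
    unfolding is_arc_def by blast
  then have "Q \<in> S"
    using arc unfolding is_arc_def by (metis subset_insert)
  then have "card (S - {Q}) = 2" using S by simp
  then obtain A B where AB: "S - {Q} = {A, B}" "A \<noteq> B" by (auto simp: card_2_iff)
  obtain L where "L \<in> proj_lines" "\<forall>P\<in>S. P \<subseteq> L"
    using S by (auto simp: proj_collinear_def)
  moreover have "A \<in> K \<inter> S" "B \<in> K \<inter> S" using AB(1) S(1) by auto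
  ultimately show ?thesis using that[of A B L] AB(2) \<open>Q \<in> S\<close> by simp
qed

text \<open>
  Instead of counting lines through \<open>P\<close>, count vectors: the planes spanned by \<open>P\<close> and the other
  points of \<open>K\<close> share the \<open>q\<close> vectors of \<open>P\<close>, and each adds at most \<open>q * (q - 1)\<close> more. Covering
  all \<open>q ^ 3\<close> vectors therefore takes at least \<open>(q ^ 3 - q) / (q * (q - 1)) = q + 1\<close> planes.
\<close>

lemma arc_all_lines_secant_card:
  fixes K :: "('a :: {field, finite} ^ 3) set set"
  assumes arc: "is_arc k K" and "P \<in> K"
    and cover: "\<And>v. v \<in> P \<or> (\<exists>B\<in>K - {P}. v \<in> vec.span (P \<union> B))"
  shows "CARD('a) + 2 \<le> k"
proof -
  let ?q = "CARD('a)"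
  have sub: "K \<subseteq> proj_points" and k: "card K = k" using arc by (auto simp: is_arc_def)
  have "\<forall>B\<in>K. \<exists>b. B = vec.span {b}" using sub proj_point_span by (metis subsetD)
  then obtain r where r: "\<And>B. B \<in> K \<Longrightarrow> B = vec.span {r B}" by metis
  define T where "T = (\<Union>B\<in>K - {P}. (\<lambda>(x, y). x *s r P + y *s r B) ` (UNIV \<times> (UNIV - {0})))"
  have "v \<in> range (\<lambda>x. x *s r P) \<union> T" for v
    using cover[of v]
  proof
    assume "v \<in> P"
    then show ?thesis using r[OF \<open>P \<in> K\<close>] by (metis UnI1 vec.span_singleton)
  next
    assume "\<exists>B\<in>K - {P}. v \<in> vec.span (P \<union> B)"
    then obtain B where B: "B \<in> K - {P}" "v \<in> vec.span (P \<union> B)" by blast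
    moreover have "vec.span P = vec.span {r P}" "vec.span B = vec.span {r B}"
      using r[OF \<open>P \<in> K\<close>] r[of B] B(1) by (metis DiffD1 vec.span_span)+
    ultimately obtain x y where "v = x *s r P + y *s r B"
      by (auto simp: vec.span_Un vec.span_singleton)
    then show ?thesis using B by (cases "y = 0") (force simp: T_def)+
  qed
  then have "CARD('a ^ 3) \<le> card (range (\<lambda>x. x *s r P) \<union> T)"
    by (metis (no_types, lifting) UNIV_eq_I order_refl)
  also have "\<dots> \<le> card (range (\<lambda>x::'a. x *s r P)) + card T" by (rule card_Un_le)
  also have "card (range (\<lambda>x::'a. x *s r P)) \<le> ?q" by (rule card_image_le) simp
  also have "card T \<le> (\<Sum>B\<in>K - {P}. card ((\<lambda>(x, y). x *s r P + y *s r B) ` (UNIV \<times> (UNIV - {0::'a}))))"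
    unfolding T_def by (rule card_UN_le) simp
  also have "\<dots> \<le> (\<Sum>B\<in>K - {P}. ?q * (?q - 1))"
  proof (rule sum_mono)
    fix B
    show "card ((\<lambda>(x, y). x *s r P + y *s r B) ` (UNIV \<times> (UNIV - {0::'a}))) \<le> ?q * (?q - 1)"
      by (rule order_trans[OF card_image_le]) (auto simp: card_cartesian_product card_Diff_singleton)
  qed
  also have "\<dots> = (k - 1) * (?q * (?q - 1))" using k \<open>P \<in> K\<close> by simp
  finally have le: "?q ^ 3 \<le> ?q + (k - 1) * (?q * (?q - 1))" by simp
  have q: "?q \<ge> 2"
    using card_mono[of UNIV "{0, 1 :: 'a}"] by simp
  show ?thesis
  proof (rule ccontr)
    assume "\<not> ?thesis"
    then have "k - 1 \<le> ?q" by simp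
    then have "?q ^ 3 \<le> ?q + ?q * (?q * (?q - 1))"
      using le by (meson add_left_mono mult_le_mono1 order_trans)
    moreover obtain n where "?q = Suc (Suc n)" using q by (metis Suc_le_D numeral_2_eq_2 Suc_le_mono)
    ultimately show False by (simp add: power3_eq_cube algebra_simps)
  qed
qed

text \<open>
  The vectors \<open>v + c *s p\<close>, with \<open>P\<close> spanned by \<open>p\<close> and \<open>c\<close> running over the field, represent the
  \<open>q\<close> points other than \<open>P\<close> of the tangent spanned by \<open>P\<close> and \<open>v\<close>. A secant through one of
  these points and \<open>P\<close> would be that tangent and also the join of \<open>P\<close> with another point of
  \<open>K\<close>, which is impossible. Hence the pairs on the secants avoid \<open>P\<close>. They are distinct, since
  a line through two of the points \<open>v + c *s p\<close> contains \<open>P\<close>.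
\<close>

lemma complete_arc_tangent_card:
  fixes K :: "('a :: {field, finite} ^ 3) set set"
  assumes compl: "is_complete_arc k K" and "P \<in> K"
    and tangent: "\<And>B. B \<in> K - {P} \<Longrightarrow> v \<notin> vec.span (P \<union> B)" and v: "v \<notin> P"
  shows "CARD('a) \<le> (k - 1) choose 2"
proof -
  have arc: "is_arc k K" using compl by (simp add: is_complete_arc_def)
  have sub: "K \<subseteq> proj_points" and k: "card K = k" using arc by (auto simp: is_arc_def)
  obtain p where p: "p \<noteq> 0" "P = vec.span {p}" using sub \<open>P \<in> K\<close> proj_point_span by blast
  have pP: "p \<in> P" using p by (simp add: vec.span_base)
  have subP: "vec.subspace P" using p by simp
  define pt where "pt c = vec.span {v + c *s p}" for c
  have base: "v + c *s p \<in> pt c" for c by (simp add: pt_def vec.span_base)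
  have recover: "v \<in> M" if "vec.subspace M" "P \<subseteq> M" "v + c *s p \<in> M" for M c
    using vec.subspace_diff[OF that(1,3) vec.subspace_scale[OF that(1), of p c]] pP that(2)
    by auto
  have pt: "pt c \<in> proj_points" for c
  proof -
    have "v + c *s p \<noteq> 0"
      using recover[OF subP order_refl, of c] v vec.subspace_0[OF subP] by auto
    then show ?thesis unfolding pt_def by (rule span_nonzero_in_proj_points)
  qed
  have "pt c \<notin> K" for c
  proof
    assume "pt c \<in> K"
    moreover have "pt c \<noteq> P" using recover[OF subP order_refl] v base[of c] by metis
    moreover have "v \<in> vec.span (P \<union> pt c)"
      by (rule recover[of _ c]) (use base in \<open>auto intro: vec.span_base\<close>)
    ultimately show False using tangent by blast
  qed
  then have "\<exists>A B L. A \<in> K \<and> B \<in> K \<and> A \<noteq> B \<and> L \<in> proj_lines \<and> A \<subseteq> L \<and> B \<subseteq> L \<and> pt c \<subseteq> L" for c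
    using complete_arc_secant_through[OF compl pt[of c]] by metis
  then obtain A B L where ABL: "\<And>c. A c \<in> K" "\<And>c. B c \<in> K" "\<And>c. A c \<noteq> B c"
    "\<And>c. L c \<in> proj_lines" "\<And>c. A c \<subseteq> L c" "\<And>c. B c \<subseteq> L c" "\<And>c. pt c \<subseteq> L c"
    by metis
  have Lsub: "vec.subspace (L c)" for c using ABL(4) by (simp add: proj_lines_def)
  \<comment> \<open>The secant chosen through \<open>pt c\<close> has a point \<open>C \<noteq> P\<close> of the arc on it, so if it contained
    \<open>P\<close> it would be the join of \<open>P\<close> and \<open>C\<close> and would contain \<open>v\<close>.\<close>
  have off: "\<not> P \<subseteq> L c" for c
  proof
    assume PL: "P \<subseteq> L c"
    obtain C where C: "C \<in> K - {P}" "C \<subseteq> L c"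
      using ABL(1-3,5,6)[of c] by (metis DiffI singletonD)
    have "L c = vec.span (P \<union> C)"
      using proj_line_eq_join[of P C "L c"] C sub \<open>P \<in> K\<close> ABL(4) PL by blast
    moreover have "v \<in> L c"
      by (rule recover[OF Lsub PL, of c]) (use base ABL(7) in blast)
    ultimately show False using tangent C by blast
  qed
  have "inj (\<lambda>c. {A c, B c})"
  proof (rule injI)
    fix c d
    assume eq: "{A c, B c} = {A d, B d}"
    have L: "L e = vec.span (A e \<union> B e)" for e
      using proj_line_eq_join[of "A e" "B e" "L e"] ABL sub by blast
    have "A c \<union> B c = A d \<union> B d" using eq by (metis Union_insert ccpo_Sup_singleton)
    then have LL: "L c = L d" using L by metis
    show "c = d"
    proof (rule ccontr)
      assume "c \<noteq> d"
      have "v + c *s p \<in> L c" "v + d *s p \<in> L c" using base ABL(7) LL by blast+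
      then have "(v + c *s p) - (v + d *s p) \<in> L c" by (rule vec.subspace_diff[OF Lsub])
      then have "(c - d) *s p \<in> L c" by (simp add: vec.scale_left_diff_distrib)
      then have "inverse (c - d) *s ((c - d) *s p) \<in> L c" by (rule vec.subspace_scale[OF Lsub])
      then have "p \<in> L c" using \<open>c \<noteq> d\<close> by simp
      then have "P \<subseteq> L c" using p Lsub by (simp add: vec.span_minimal)
      then show False using off by blast
    qed
  qed
  moreover have "range (\<lambda>c. {A c, B c}) \<subseteq> {S. S \<subseteq> K - {P} \<and> card S = 2}"
    using ABL off by fastforce
  ultimately have "CARD('a) \<le> card {S. S \<subseteq> K - {P} \<and> card S = 2}"
    by (intro card_inj_on_le) auto
  also have "\<dots> = (k - 1) choose 2" using k \<open>P \<in> K\<close> by (simp add: n_subsets)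
  finally show ?thesis .
qed

lemma complete_arc_nonempty:
  assumes "is_complete_arc k (K :: ('a :: {field, finite} ^ 3) set set)"
  shows "K \<noteq> {}"
proof
  assume "K = {}"
  moreover have "vec.span {1 :: 'a ^ 3} \<in> proj_points"
    by (rule span_nonzero_in_proj_points) simp
  ultimately show False using complete_arc_secant_through[OF assms] by (metis empty_iff)
qed

text \<open>
  The exceptional case, where every line through \<open>P\<close> is a secant, is harmless because
  \<open>(k - 1) * (k - 2) \<ge> (q + 1) * q \<ge> 2 * q\<close> there.
\<close>

lemma complete_arc_card_bound:
  assumes compl: "is_complete_arc k (K :: ('a :: {field, finite} ^ 3) set set)"
  shows "2 * CARD('a) \<le> (k - 1) * (k - 2)"
proof -
  obtain P where P: "P \<in> K" using complete_arc_nonempty[OF compl] by blast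
  have arc: "is_arc k K" using compl by (simp add: is_complete_arc_def)
  have q: "CARD('a) > 0" by simp
  show ?thesis
  proof (cases "\<forall>v. v \<in> P \<or> (\<exists>B\<in>K - {P}. v \<in> vec.span (P \<union> B))")
    case True
    then have "CARD('a) + 2 \<le> k" using arc_all_lines_secant_card[OF arc P] by blast
    then have "(CARD('a) + 1) * CARD('a) \<le> (k - 1) * (k - 2)" by (intro mult_le_mono) auto
    moreover have "2 * CARD('a) \<le> (CARD('a) + 1) * CARD('a)" using q by (intro mult_le_mono) linarith+
    ultimately show ?thesis by linarith
  next
    case False
    then obtain v where v: "v \<notin> P" "\<And>B. B \<in> K - {P} \<Longrightarrow> v \<notin> vec.span (P \<union> B)" by blast
    have "CARD('a) \<le> (k - 1) choose 2"
      using complete_arc_tangent_card[OF compl P] v by blast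
    also have "\<dots> = (k - 1) * (k - 2) div 2"
      using choose_two[of "k - 1"] by (simp add: numeral_2_eq_2)
    finally show ?thesis by linarith
  qed
qed

text \<open>An arc of maximum size is complete.\<close>

lemma complete_arc_exists: "\<exists>k (K :: ('a :: {field, finite} ^ 3) set set). is_complete_arc k K"
proof -
  let ?arc = "\<lambda>k. \<exists>K :: ('a ^ 3) set set. is_arc k K"
  have zero: "?arc 0" by (rule exI[of _ "{}"]) (simp add: is_arc_def)
  have bounded: "l \<le> CARD(('a ^ 3) set)" if "?arc l" for l
    using that unfolding is_arc_def by (metis card_mono finite subset_UNIV)
  have greatest: "?arc (Greatest ?arc)" "\<And>l. ?arc l \<Longrightarrow> l \<le> Greatest ?arc"
    using GreatestI_nat[of ?arc, OF zero bounded] Greatest_le_nat[of ?arc, OF _ bounded] by simp_all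
  then show ?thesis
    unfolding is_complete_arc_def by (metis Suc_eq_plus1 not_less_eq_eq order_refl)
qed

theorem proposition6:
  fixes q :: nat
  assumes "primepow q" and "q \<ge> 2"
    and "CARD('a :: {field, finite}) = q"
  shows "int (t2 TYPE('a)) \<ge> \<lceil>sqrt (2 * real q + 1 / 4) + 3 / 2\<rceil>"
proof -
  let ?k = "t2 TYPE('a)"
  have "\<exists>K :: ('a ^ 3) set set. is_complete_arc ?k K"
    unfolding t2_def by (rule LeastI_ex) (rule complete_arc_exists)
  then have bound: "2 * q \<le> (?k - 1) * (?k - 2)"
    using complete_arc_card_bound assms(3) by blast
  \<comment> \<open>Below 3 the truncated product vanishes; from there on it agrees with the real one.\<close>
  then have k: "?k > 2" using assms(2) by (cases "?k \<le> 2") auto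
  have "2 * real q \<le> (real ?k - 1) * (real ?k - 2)"
  proof -
    have "real (2 * q) \<le> real ((?k - 1) * (?k - 2))" using bound by (rule of_nat_mono)
    then show ?thesis using k by simp
  qed
  then have "2 * real q + 1 / 4 \<le> (real ?k - 3 / 2)\<^sup>2"
    by (simp add: power2_eq_square algebra_simps)
  then have "sqrt (2 * real q + 1 / 4) \<le> real ?k - 3 / 2"
    using k by (intro real_le_lsqrt) auto
  then show ?thesis by (simp add: ceiling_le_iff)
qed

end
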